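(* Let $\operatorname{dom}\Gamma$ be closed, and let $\Gamma$ be locally bounded and lower semicontinuous w.r.t. its domain at each point from $\operatorname{dom}\Gamma$. Then $\operatorname{gph}\Psi_{\mathrm w}$ and $\operatorname{gph}\Phi_{\mathrm w}$ are closed.
   Context: Setting: $f\colon\mathbb R^n\times\mathbb R^m\to\mathbb R^q$ is continuous, $\mathcal C\subset\mathbb R^q$ is a nonempty, closed, convex, pointed cone with nonempty interior, and $\Gamma\colon\mathbb R^n\rightrightarrows\mathbb R^m$ is a set-valued mapping (values may be empty) with closed graph. For $x\in\mathbb R^n$ let $f(x,A):=\{f(x,y)\mid y\in A\}$ and define $\Psi_{\mathrm w}(x):=\{y\in\Gamma(x)\mid (\{f(x,y)\}-\operatorname{int}\mathcal C)\cap f(x,\Gamma(x))=\emptyset\}$ and $\Phi_{\mathrm w}(x):=f(x,\Psi_{\mathrm w}(x))$. For a set-valued mapping $\Upsilon\colon\mathbb R^n\rightrightarrows\mathbb R^\ell$: $\operatorname{gph}\Upsilon:=\{(x,y)\mid y\in\Upsilon(x)\}$, $\operatorname{dom}\Upsilon:=\{x\mid\Upsilon(x)\neq\emptyset\}$. For $\bar x\in\operatorname{dom}\Upsilon$: $\Upsilon$ is locally bounded at $\bar x$ if there are a bounded set $B$ and a neighborhood $U$ of $\bar x$ with $\Upsilon(x)\subset B$ for all $x\in U$; $\Upsilon$ is lower semicontinuous at $\bar x$ w.r.t. $\Omega\subset\mathbb R^n$ if for each open set $V$ with $\Upsilon(\bar x)\cap V\neq\emptyset$ there is a neighborhood $U$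 of $\bar x$ such that $\Upsilon(x)\cap V\neq\emptyset$ for all $x\in\Omega\cap U$. *)

theory Defs
  imports "HOL-Analysis.Analysis"
begin

text \<open>
  A set-valued mapping from \<open>'a\<close> to \<open>'b\<close> is a function \<open>'a \<Rightarrow> 'b set\<close>; values may be empty.
\<close>

definition gph :: "('a \<Rightarrow> 'b set) \<Rightarrow> ('a \<times> 'b) set" where
  "gph \<Upsilon> = {(x, y). y \<in> \<Upsilon> x}"

definition sdom :: "('a \<Rightarrow> 'b set) \<Rightarrow> 'a set" where
  "sdom \<Upsilon> = {x. \<Upsilon> x \<noteq> {}}"

text \<open>
  Neighbourhoods are taken to be open, which is no restriction in the following two notions.
\<close>

definition locally_bounded_at ::
    "('a::topological_space \<Rightarrow> 'b::metric_space set) \<Rightarrow> 'a \<Rightarrow> bool" where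
  "locally_bounded_at \<Upsilon> xbar \<longleftrightarrow>
     (\<exists>B U. bounded B \<and> open U \<and> xbar \<in> U \<and> (\<forall>x\<in>U. \<Upsilon> x \<subseteq> B))"

definition lsc_at_wrt ::
    "('a::topological_space \<Rightarrow> 'b::topological_space set) \<Rightarrow> 'a \<Rightarrow> 'a set \<Rightarrow> bool" where
  "lsc_at_wrt \<Upsilon> xbar \<Omega> \<longleftrightarrow>
     (\<forall>V. open V \<and> \<Upsilon> xbar \<inter> V \<noteq> {} \<longrightarrow>
        (\<exists>U. open U \<and> xbar \<in> U \<and> (\<forall>x\<in>\<Omega> \<inter> U. \<Upsilon> x \<inter> V \<noteq> {})))"

definition pointed :: "'a::real_vector set \<Rightarrow> bool" where
  "pointed C \<longleftrightarrow> C \<inter> uminus ` C = {0}"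

definition image_at :: "('a \<times> 'b \<Rightarrow> 'c) \<Rightarrow> 'a \<Rightarrow> 'b set \<Rightarrow> 'c set" where
  "image_at f x A = {f (x, y) |y. y \<in> A}"

definition Psi_w ::
    "('a \<times> 'b \<Rightarrow> 'c::real_normed_vector) \<Rightarrow> 'c set \<Rightarrow> ('a \<Rightarrow> 'b set) \<Rightarrow> 'a \<Rightarrow> 'b set" where
  "Psi_w f C \<Gamma> x =
     {y \<in> \<Gamma> x. {f (x, y) - c |c. c \<in> interior C} \<inter> image_at f x (\<Gamma> x) = {}}"

definition Phi_w ::
    "('a \<times> 'b \<Rightarrow> 'c::real_normed_vector) \<Rightarrow> 'c set \<Rightarrow> ('a \<Rightarrow> 'b set) \<Rightarrow> 'a \<Rightarrow> 'c set" where
  "Phi_w f C \<Gamma> x = image_at f x (Psi_w f C \<Gamma> x)"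

end

theory Submission
  imports Defs
begin

text \<open>
  If \<open>z \<in> \<Gamma> x\<close> dominates \<open>y\<close> at \<open>x\<close>, then by openness of \<open>interior C\<close> and
  continuity of \<open>f\<close> every \<open>z'\<close> near \<open>z\<close> dominates every \<open>y'\<close> near \<open>y\<close> at all \<open>x'\<close> near
  \<open>x\<close>, and lower semicontinuity provides such a \<open>z' \<in> \<Gamma> x'\<close>. So non-dominance passes to
  limits. Local boundedness yields convergent subsequences of preimages, which transfers
  closedness to the image mapping.
\<close>

lemma mem_gph [simp]: "(x, y) \<in> gph \<Upsilon> \<longleftrightarrow> y \<in> \<Upsilon> x"
  by (simp add: gph_def)

lemma mem_image_at: "v \<in> image_at f x A \<longleftrightarrow> (\<exists>y\<in>A. v = f (x, y))"
  by (auto simp: image_at_def)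

text \<open>Solving \<open>f (x, z) = f (x, y) - c\<close> for \<open>c\<close> turns dominance into
  membership of a difference of values in the open set \<open>interior C\<close>, a form suited to
  continuity arguments.\<close>

lemma mem_Psi_w:
  "y \<in> Psi_w f C \<Gamma> x \<longleftrightarrow> y \<in> \<Gamma> x \<and> (\<forall>z\<in>\<Gamma> x. f (x, y) - f (x, z) \<notin> interior C)"
proof -
  have eq: "f (x, z) = f (x, y) - c \<longleftrightarrow> c = f (x, y) - f (x, z)" for z c
    by (metis diff_diff_eq2 add_diff_cancel_left')
  show ?thesis
    by (simp add: Psi_w_def image_at_def disjoint_iff) (metis eq)
qed

lemma closed_gph_Psi_w:
  fixes f :: "'a::metric_space \<times> 'b::metric_space \<Rightarrow> 'c::real_normed_vector"
  assumes f: "continuous_on UNIV f"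
    and gph: "closed (gph \<Gamma>)"
    and lsc: "\<And>x. x \<in> sdom \<Gamma> \<Longrightarrow> lsc_at_wrt \<Gamma> x (sdom \<Gamma>)"
  shows "closed (gph (Psi_w f C \<Gamma>))"
  unfolding closed_sequential_limits
proof safe
  fix s x y
  assume s: "\<forall>n. s n \<in> gph (Psi_w f C \<Gamma>)" and lim: "s \<longlonglongrightarrow> (x, y)"
  have s_mem: "snd (s n) \<in> Psi_w f C \<Gamma> (fst (s n))" for n
    using s[rule_format, of n] by (cases "s n") simp
  have "s n \<in> gph \<Gamma>" for n
    using s_mem[of n] by (cases "s n") (simp add: mem_Psi_w)
  then have y: "y \<in> \<Gamma> x"
    using closed_sequentially[OF gph _ lim] by simp
  have "f (x, y) - f (x, z) \<notin> interior C" if z: "z \<in> \<Gamma> x" for z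
  proof
    assume dom: "f (x, y) - f (x, z) \<in> interior C"
    \<comment> \<open>As a function of the triple (x, y, z) the difference is jointly continuous, so
      dominance is an open condition. It therefore holds on a whole box \<open>X\<close> \<times>
      \<open>Y\<close> \<times> \<open>Z\<close>, in which the three entries vary
      independently.\<close>
    define g where "g = (\<lambda>p. f (fst p, fst (snd p)) - f (fst p, snd (snd p)))"
    have "continuous_on UNIV g"
      unfolding g_def
      by (intro continuous_intros continuous_on_compose2[OF f]) auto
    then have "open (g -` interior C)"
      by (simp add: open_vimage)
    moreover have "(x, y, z) \<in> g -` interior C"
      using dom by (simp add: g_def)
    ultimately obtain X W where XW: "open X" "open W" "x \<in> X" "(y, z) \<in> W"
        "X \<times> W \<subseteq> g -` interior C"
      by (rule open_prod_elim) (blast intro: that)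
    obtain Y Z where YZ: "open Y" "open Z" "y \<in> Y" "z \<in> Z" "Y \<times> Z \<subseteq> W"
      using XW(2,4) by (rule open_prod_elim) (blast intro: that)
    have "lsc_at_wrt \<Gamma> x (sdom \<Gamma>)"
      using y by (intro lsc) (auto simp: sdom_def)
    moreover have "\<Gamma> x \<inter> Z \<noteq> {}"
      using z YZ(4) by blast
    ultimately obtain U where U: "open U" "x \<in> U" "\<forall>x'\<in>sdom \<Gamma> \<inter> U. \<Gamma> x' \<inter> Z \<noteq> {}"
      using YZ(2) unfolding lsc_at_wrt_def by metis
    have "open ((X \<inter> U) \<times> Y)" "(x, y) \<in> (X \<inter> U) \<times> Y"
      using XW(1,3) YZ(1,3) U(1,2) by (auto intro: open_Times)
    then have "\<forall>\<^sub>F n in sequentially. s n \<in> (X \<inter> U) \<times> Y"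
      by (rule topological_tendstoD[OF lim])
    then obtain n where "s n \<in> (X \<inter> U) \<times> Y"
      using eventually_happens'[OF sequentially_bot] by fastforce
    then have n: "fst (s n) \<in> X" "fst (s n) \<in> U" "snd (s n) \<in> Y"
      by auto
    \<comment> \<open>Lower semicontinuity is only relative to the domain, so it applies at
      \<open>fst (s n)\<close> only once this value of \<open>\<Gamma>\<close> is known to be
      nonempty; \<open>snd (s n)\<close> is an element of it.\<close>
    have "fst (s n) \<in> sdom \<Gamma>"
      using s_mem[of n] by (auto simp: sdom_def mem_Psi_w)
    then obtain z' where "z' \<in> \<Gamma> (fst (s n))" "z' \<in> Z"
      using U(3) n(2) by blast
    moreover have "(fst (s n), snd (s n), z') \<in> g -` interior C"
      using XW(5) YZ(5) n(1,3) \<open>z' \<in> Z\<close> by blast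
    ultimately show False
      using s_mem[of n] by (simp add: mem_Psi_w g_def)
  qed
  with y show "(x, y) \<in> gph (Psi_w f C \<Gamma>)"
    by (simp add: mem_Psi_w)
qed

text \<open>The preimages \<open>y n\<close> lie in values of \<open>\<Psi>\<close>, hence of
  \<open>\<Gamma>\<close>, so compactness can be drawn from \<open>\<Gamma>\<close> while the closed
  graph of \<open>\<Psi>\<close> keeps their limit admissible. This permits \<open>\<Psi>\<close> to
  have a smaller domain than \<open>\<Gamma>\<close>.\<close>

lemma closed_gph_image_at:
  fixes f :: "'a::metric_space \<times> 'b::heine_borel \<Rightarrow> 'c::metric_space"
  assumes f: "continuous_on UNIV f"
    and gph: "closed (gph \<Psi>)"
    and sub: "\<And>x. \<Psi> x \<subseteq> \<Gamma> x"
    and dom: "closed (sdom \<Gamma>)"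
    and lb: "\<And>x. x \<in> sdom \<Gamma> \<Longrightarrow> locally_bounded_at \<Gamma> x"
  shows "closed (gph (\<lambda>x. image_at f x (\<Psi> x)))"
  unfolding closed_sequential_limits
proof safe
  fix s x v
  assume s: "\<forall>n. s n \<in> gph (\<lambda>x. image_at f x (\<Psi> x))" and lim: "s \<longlonglongrightarrow> (x, v)"
  have "\<exists>y. y \<in> \<Psi> (fst (s n)) \<and> snd (s n) = f (fst (s n), y)" for n
    using s[rule_format, of n] by (cases "s n") (auto simp: mem_image_at)
  then obtain y where y: "\<And>n. y n \<in> \<Psi> (fst (s n))"
    and v: "\<And>n. snd (s n) = f (fst (s n), y n)"
    by metis
  have lim_x: "(\<lambda>n. fst (s n)) \<longlonglongrightarrow> x" and lim_v: "(\<lambda>n. snd (s n)) \<longlonglongrightarrow> v"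
    using tendsto_fst[OF lim] tendsto_snd[OF lim] by simp_all
  have "fst (s n) \<in> sdom \<Gamma>" for n
    using y[of n] sub by (auto simp: sdom_def)
  \<comment> \<open>Local boundedness is available only at points of the domain; its closedness
    places the limit \<open>x\<close> there.\<close>
  then have "x \<in> sdom \<Gamma>"
    by (rule closed_sequentially[OF dom _ lim_x])
  then obtain B U where B: "bounded B" and U: "open U" "x \<in> U" "\<And>x'. x' \<in> U \<Longrightarrow> \<Gamma> x' \<subseteq> B"
    using lb[OF \<open>x \<in> sdom \<Gamma>\<close>] unfolding locally_bounded_at_def by auto
  obtain N where N: "\<And>n. n \<ge> N \<Longrightarrow> fst (s n) \<in> U"
    using topological_tendstoD[OF lim_x U(1,2)] by (auto simp: eventually_sequentially)
  \<comment> \<open>Only the tail is known to stay in \<open>B\<close>, so the sequence is shifted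
    by \<open>N\<close> to make its entire range bounded.\<close>
  have "y (n + N) \<in> B" for n
    using y[of "n + N"] sub U(3)[OF N[of "n + N"]] by auto
  then have bdd: "bounded (range (\<lambda>n. y (n + N)))"
    by (intro bounded_subset[OF B]) auto
  obtain l r where r: "strict_mono (r :: nat \<Rightarrow> nat)"
    and l: "((\<lambda>n. y (n + N)) \<circ> r) \<longlonglongrightarrow> l"
    using bounded_imp_convergent_subsequence[OF bdd] by auto
  \<comment> \<open>Shift and extraction merge into one subsequence of the original indices, along
    which \<open>s\<close> still converges.\<close>
  define k where "k n = r n + N" for n
  have k: "strict_mono k"
    using r by (simp add: k_def strict_mono_def)
  have lim_y: "(\<lambda>n. y (k n)) \<longlonglongrightarrow> l"
    using l by (simp add: k_def o_def)
  have lim_xk: "(\<lambda>n. fst (s (k n))) \<longlonglongrightarrow> x" and lim_vk: "(\<lambda>n. snd (s (k n))) \<longlonglongrightarrow> v"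
    using LIMSEQ_subseq_LIMSEQ[OF lim_x k] LIMSEQ_subseq_LIMSEQ[OF lim_v k]
    by (simp_all add: o_def)
  have lim_xy: "(\<lambda>n. (fst (s (k n)), y (k n))) \<longlonglongrightarrow> (x, l)"
    by (intro tendsto_Pair lim_xk lim_y)
  have "l \<in> \<Psi> x"
    using closed_sequentially[OF gph _ lim_xy] y by simp
  moreover have "(\<lambda>n. snd (s (k n))) \<longlonglongrightarrow> f (x, l)"
    using continuous_on_tendsto_compose[OF f lim_xy] by (simp add: v)
  then have "v = f (x, l)"
    by (rule LIMSEQ_unique[OF lim_vk])
  ultimately show "(x, v) \<in> gph (\<lambda>x. image_at f x (\<Psi> x))"
    by (auto simp: mem_image_at)
qed

theorem corollary3p6:
  fixes f :: "(real ^ 'n) \<times> (real ^ 'm) \<Rightarrow> real ^ 'q"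
    and C :: "(real ^ 'q) set"
    and \<Gamma> :: "real ^ 'n \<Rightarrow> (real ^ 'm) set"
  assumes "continuous_on UNIV f"
    and "C \<noteq> {}" and "closed C" and "convex C" and "cone C" and "pointed C"
    and "interior C \<noteq> {}"
    and "closed (gph \<Gamma>)"
    and "closed (sdom \<Gamma>)"
    and "\<forall>x\<in>sdom \<Gamma>. locally_bounded_at \<Gamma> x"
    and "\<forall>x\<in>sdom \<Gamma>. lsc_at_wrt \<Gamma> x (sdom \<Gamma>)"
  shows "closed (gph (Psi_w f C \<Gamma>)) \<and> closed (gph (Phi_w f C \<Gamma>))"
proof
  show Psi: "closed (gph (Psi_w f C \<Gamma>))"
    using assms by (intro closed_gph_Psi_w) auto
  have "closed (gph (\<lambda>x. image_at f x (Psi_w f C \<Gamma> x)))"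
    \<comment> \<open>The dominating mapping does not occur in the conclusion of the lemma, so
      unification cannot find it.\<close>
    using assms Psi by (intro closed_gph_image_at[where \<Gamma> = \<Gamma>]) (auto simp: mem_Psi_w)
  then show "closed (gph (Phi_w f C \<Gamma>))"
    unfolding Phi_w_def[abs_def] .
qed

end
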